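(* Let $d\ge 2$, let $(g_j)_{j\ge 1}$ be a sequence of independent random matrices with values in $GL(d,\mathbb{R})$ and let $x_0\in\mathbb{R}^d$ be a fixed unit vector. Assume that $$\sup_j\|N(g_j)\|_{L^\infty}<\infty ,$$ and that (average logarithmic contraction) there exist $n_0\in\mathbb{N}$ and $\delta>0$ such that $$\sup_j\sup_{\bar x\neq\bar y}\mathbb{E}\left[\ln\left(\frac{d(g_{j,n_0}\bar x,g_{j,n_0}\bar y)}{d(\bar x,\bar y)}\right)\right]\le-\delta .$$ Extend $(g_j)$ to a two-sided sequence by setting $g_k=A$ for $k<1$, for some fixed invertible matrix $A$. Then there exists $\rho\in(0,1)$ such that for all finite $p\ge1$, $$\sup_{k}\sup_{r}\rho^{-r/p}\left\|X_k-\mathbb{E}[X_k\,|\,g_k,g_{k-1},\dots,g_{k-r}]\right\|_{L^p}<\infty ,$$ where the suprema are over integers $k\ge1$ and $r\ge0$.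
   Context: $\|\cdot\|$ is the Euclidean norm and the induced operator norm; $N(g)=\max(\|g\|,\|g^{-1}\|)$. On the projective space $P(\mathbb{R}^d)$, $d(\bar x,\bar y)=\|x\wedge y\|$ where $x,y$ are unit vectors with directions $\bar x,\bar y$ (the sine of the angle between them). $g_{j,n}=g_{j+n-1}\cdots g_{j+1}g_j$, acting on $P(\mathbb{R}^d)$ in the natural way. For $y\neq0$, $\sigma(g,y)=\ln(\|gy\|/\|y\|)$. The variables $X_k$ are defined by $X_k=\sigma(g_k,\,g_{k-1}\cdots g_1x_0)$ for $k\ge1$ (with $X_1=\sigma(g_1,x_0)$), so that $\ln\|g_n\cdots g_1x_0\|=X_1+\dots+X_n$. *)

theory Defs
  imports "HOL-Probability.Probability"
begin

text \<open>
  The library norm on \<^typ>\<open>real^'n^'n\<close> is the Frobenius norm, so the operator norm induced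
  by the Euclidean norm is written with \<^const>\<open>onorm\<close>.
\<close>

definition mat_N :: "real^'n^'n \<Rightarrow> real" where
  "mat_N g = max (onorm (\<lambda>v. g *v v)) (onorm (\<lambda>v. matrix_inv g *v v))"

definition cocycle :: "real^'n^'n \<Rightarrow> real^'n \<Rightarrow> real" where
  "cocycle g y = ln (norm (g *v y) / norm y)"

text \<open>\<open>mat_prod h j n\<close> is the product \<open>h (j+n-1) ** \<dots> ** h (j+1) ** h j\<close> of \<open>n\<close> factors.\<close>

primrec mat_prod :: "(nat \<Rightarrow> real^'n^'n) \<Rightarrow> nat \<Rightarrow> nat \<Rightarrow> real^'n^'n" where
  "mat_prod h j 0 = mat 1"
| "mat_prod h j (Suc n) = h (j + n) ** mat_prod h j n"

text \<open>
  The Euclidean norm of \<open>x \<and> y\<close> in the second exterior power. The coordinates of \<open>x \<and> y\<close> in the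
  orthonormal basis \<open>e\<^sub>i \<and> e\<^sub>j\<close> (\<open>i < j\<close>) are \<open>x\<^sub>i y\<^sub>j - x\<^sub>j y\<^sub>i\<close>; summing over all ordered pairs
  counts each of them twice.
\<close>

definition wedge_norm :: "real^'n \<Rightarrow> real^'n \<Rightarrow> real" where
  "wedge_norm x y = sqrt ((\<Sum>i\<in>UNIV. \<Sum>j\<in>UNIV. (x $ i * y $ j - x $ j * y $ i)\<^sup>2) / 2)"

text \<open>
  Points of the projective space are lines through the origin; an invertible matrix \<open>g\<close> acts by
  \<open>L \<mapsto> (\<lambda>v. g *v v) ` L\<close>.
\<close>

definition proj_space :: "(real^'n) set set" where
  "proj_space = {span {x} | x. x \<noteq> 0}"

definition proj_act :: "real^'n^'n \<Rightarrow> (real^'n) set \<Rightarrow> (real^'n) set" where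
  "proj_act g L = (\<lambda>v. g *v v) ` L"

definition proj_dist :: "(real^'n) set \<Rightarrow> (real^'n) set \<Rightarrow> real" where
  "proj_dist L L' =
     (THE c. \<exists>x\<in>L. \<exists>y\<in>L'. norm x = 1 \<and> norm y = 1 \<and> c = wedge_norm x y)"

lemma wedge_norm_scale: "wedge_norm (a *\<^sub>R x) (b *\<^sub>R y) = \<bar>a\<bar> * \<bar>b\<bar> * wedge_norm x y"
proof -
  have eq: "(\<Sum>i\<in>UNIV. \<Sum>j\<in>UNIV. ((a *\<^sub>R x) $ i * (b *\<^sub>R y) $ j - (a *\<^sub>R x) $ j * (b *\<^sub>R y) $ i)\<^sup>2)
      = (a * b)\<^sup>2 * (\<Sum>i\<in>UNIV. \<Sum>j\<in>UNIV. (x $ i * y $ j - x $ j * y $ i)\<^sup>2)"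
    unfolding sum_distrib_left
    by (intro sum.cong refl) (simp add: power2_eq_square algebra_simps)
  show ?thesis
    unfolding wedge_norm_def eq times_divide_eq_right[symmetric] real_sqrt_mult
    by (simp add: abs_mult)
qed

text \<open>\<^const>\<open>proj_dist\<close> is well defined: it does not depend on the choice of unit vectors.\<close>

lemma proj_dist_span:
  assumes "x \<noteq> 0" "y \<noteq> 0"
  shows "proj_dist (span {x}) (span {y}) = wedge_norm x y / (norm x * norm y)"
  unfolding proj_dist_def
proof (rule the_equality)
  show "\<exists>u\<in>span {x}. \<exists>v\<in>span {y}. norm u = 1 \<and> norm v = 1
          \<and> wedge_norm x y / (norm x * norm y) = wedge_norm u v"
    using assms
    by (intro bexI[of _ "(1 / norm x) *\<^sub>R x"] bexI[of _ "(1 / norm y) *\<^sub>R y"])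
       (auto simp: wedge_norm_scale span_breakdown_eq span_mul span_base)
next
  fix c
  assume "\<exists>u\<in>span {x}. \<exists>v\<in>span {y}. norm u = 1 \<and> norm v = 1 \<and> c = wedge_norm u v"
  then obtain a b where n: "norm (a *\<^sub>R x) = 1" "norm (b *\<^sub>R y) = 1"
    and c: "c = wedge_norm (a *\<^sub>R x) (b *\<^sub>R y)"
    by (auto simp: span_singleton)
  have "\<bar>a\<bar> = 1 / norm x" "\<bar>b\<bar> = 1 / norm y"
    using n assms by (auto simp: field_simps)
  then show "c = wedge_norm x y / (norm x * norm y)"
    by (simp add: c wedge_norm_scale)
qed

text \<open>The Gram determinant form of the norm of \<open>x \<and> y\<close>; for unit vectors it is the squared sine of their angle.\<close>

lemma wedge_norm_squared: "(wedge_norm x y)\<^sup>2 = (norm x)\<^sup>2 * (norm y)\<^sup>2 - (x \<bullet> y)\<^sup>2"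
proof -
  have "(\<Sum>i\<in>UNIV. \<Sum>j\<in>UNIV. (x $ i * y $ j - x $ j * y $ i)\<^sup>2)
      = (\<Sum>i\<in>UNIV. \<Sum>j\<in>UNIV. (x $ i * x $ i) * (y $ j * y $ j))
        + (\<Sum>i\<in>UNIV. \<Sum>j\<in>UNIV. (y $ i * y $ i) * (x $ j * x $ j))
        - 2 * (\<Sum>i\<in>UNIV. \<Sum>j\<in>UNIV. (x $ i * y $ i) * (x $ j * y $ j))"
    unfolding sum_distrib_left sum.distrib[symmetric] sum_subtractf[symmetric]
    by (intro sum.cong refl) (simp add: power2_eq_square algebra_simps)
  also have "\<dots> = 2 * ((x \<bullet> x) * (y \<bullet> y) - (x \<bullet> y)\<^sup>2)"
    unfolding sum_product[symmetric] by (simp add: inner_vec_def power2_eq_square)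
  finally have eq: "(\<Sum>i\<in>UNIV. \<Sum>j\<in>UNIV. (x $ i * y $ j - x $ j * y $ i)\<^sup>2)
      = 2 * ((x \<bullet> x) * (y \<bullet> y) - (x \<bullet> y)\<^sup>2)" .
  have "(x \<bullet> y)\<^sup>2 \<le> (x \<bullet> x) * (y \<bullet> y)"
    by (rule Cauchy_Schwarz_ineq)
  then show ?thesis
    by (simp add: wedge_norm_def eq power2_norm_eq_inner)
qed

definition step_var :: "(nat \<Rightarrow> 'w \<Rightarrow> real^'n^'n) \<Rightarrow> real^'n \<Rightarrow> nat \<Rightarrow> 'w \<Rightarrow> real" where
  "step_var g x0 k \<omega> = cocycle (g k \<omega>) (mat_prod (\<lambda>i. g i \<omega>) 1 (k - 1) *v x0)"

text \<open>Only the values \<open>g j\<close> with \<open>j \<ge> 1\<close> are used; \<open>g 0\<close> is irrelevant.\<close>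

definition two_sided ::
  "real^'n^'n \<Rightarrow> (nat \<Rightarrow> 'w \<Rightarrow> real^'n^'n) \<Rightarrow> int \<Rightarrow> 'w \<Rightarrow> real^'n^'n" where
  "two_sided A g k = (if k < 1 then (\<lambda>_. A) else g (nat k))"

definition gen_algebra :: "'w measure \<Rightarrow> ('i \<Rightarrow> 'w \<Rightarrow> 'b::topological_space) \<Rightarrow> 'i set \<Rightarrow> 'w measure" where
  "gen_algebra M h I = sigma (space M) (\<Union>i\<in>I. {h i -` B \<inter> space M | B. B \<in> sets borel})"

text \<open>
  The extended-valued \<open>L\<^sup>p\<close> norm for finite \<open>p\<close>, so that finiteness of a norm is not an artefact of
  the value \<open>0\<close> that the Bochner integral takes on non-integrable functions.
\<close>

definition Lp_norm :: "'w measure \<Rightarrow> real \<Rightarrow> ('w \<Rightarrow> real) \<Rightarrow> ennreal" where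
  "Lp_norm M p f =
     (let I = \<integral>\<^sup>+ \<omega>. ennreal (\<bar>f \<omega>\<bar> powr p) \<partial>M
      in if I = \<infinity> then \<infinity> else ennreal (enn2real I powr (1 / p)))"

definition Linf_norm :: "'w measure \<Rightarrow> ('w \<Rightarrow> real) \<Rightarrow> ereal" where
  "Linf_norm M f = esssup M (\<lambda>\<omega>. ereal \<bar>f \<omega>\<bar>)"

end

theory Submission
  imports Defs
begin

text \<open>
  Fix \<open>k\<close> and \<open>r < k\<close> and let \<open>j = k - r\<close>. The step \<open>X\<^sub>k\<close> depends on the matrices before time \<open>j\<close>
  only through the line spanned by \<open>Y = g\<^sub>j\<^sub>-\<^sub>1 \<dots> g\<^sub>1 x\<^sub>0\<close>. Replacing \<open>Y\<close> by the constant vector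
  \<open>x\<^sub>0\<close> gives a variable \<open>Z\<close> that is measurable with respect to \<open>g\<^sub>j, \<dots>, g\<^sub>k\<close>. The cocycle is
  Lipschitz in the line for matrices of bounded distortion (\<open>cocycle_lipschitz\<close>), so
  \<open>\<bar>X\<^sub>k - Z\<bar> \<le> c D\<close>, where \<open>D\<close> is the sine of the angle between the images of \<open>Y\<close> and \<open>x\<^sub>0\<close> under
  the same random product of the \<open>r\<close> matrices \<open>g\<^sub>j, \<dots>, g\<^sub>k\<^sub>-\<^sub>1\<close>.

  That angle shrinks exponentially in a fixed small moment. A bounded variable \<open>U\<close> of mean at
  most \<open>- \<delta>\<close> satisfies \<open>E (exp (s U)) \<le> 1 - s \<delta> / 2\<close> once \<open>s\<close> is small, because the linear term of the
  exponential beats the quadratic one. Applied to the logarithm of the factor by which a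
  block of \<open>n\<close> consecutive matrices changes an angle, this turns contraction in the mean of the logarithm into
  contraction of the \<open>s\<close>-th moment of the sine (\<open>sin_angle_moment_contraction\<close>). Each block is
  independent of the matrices before it, so the factors multiply along successive blocks
  (\<open>sin_angle_moment_decay\<close>). As \<open>0 \<le> D \<le> 1\<close> and \<open>s \<le> 1\<close>, it follows that \<open>E D \<le> E D\<^sup>s\<close> decays
  exponentially in \<open>r\<close>, at a rate independent of \<open>p\<close>.

  Finally \<open>X\<^sub>k - E(X\<^sub>k | F) = (X\<^sub>k - Z) - E(X\<^sub>k - Z | F)\<close> is at most \<open>c (D + E(D | F))\<close> in absolute
  value. A variable with values in \<open>[0, 1]\<close> dominates its \<open>p\<close>-th power, so the \<open>p\<close>-th moment of this
  bound is at most \<open>(2 c)\<^sup>p E D\<close> (\<open>cond_exp_deviation_moment\<close>). Taking the \<open>p\<close>-th root produces the rate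
  \<open>\<rho>\<^sup>r\<^sup>/\<^sup>p\<close>.
\<close>

section \<open>Angles between lines and matrices of bounded distortion\<close>

definition sin_angle :: "real^'n \<Rightarrow> real^'n \<Rightarrow> real" where
  "sin_angle x y = wedge_norm x y / (norm x * norm y)"

text \<open>
  A bound on \<^const>\<open>mat_N\<close> expressed by norms of vectors alone: the second inequality bounds the
  inverse, and in this form the condition passes to products without mentioning inverses.
\<close>

definition distortion_le :: "real \<Rightarrow> real^'n^'n \<Rightarrow> bool" where
  "distortion_le B g \<longleftrightarrow> (\<forall>v. norm (g *v v) \<le> B * norm v \<and> norm v \<le> B * norm (g *v v))"

lemma wedge_norm_nonneg: "0 \<le> wedge_norm x y"
  by (simp add: wedge_norm_def sum_nonneg)

lemma wedge_norm_le: "wedge_norm x y \<le> norm x * norm y"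
proof (rule power2_le_imp_le)
  show "(wedge_norm x y)\<^sup>2 \<le> (norm x * norm y)\<^sup>2"
    unfolding wedge_norm_squared by (simp add: power_mult_distrib)
qed simp

text \<open>
  The area of the parallelogram spanned by \<open>x\<close> and \<open>y\<close> is invariant under shears along \<open>x\<close>. Together with
  the lemma below, which shears \<open>y\<close> into the orthogonal complement of \<open>x\<close> (base times height), this
  reduces estimates of areas to estimates of lengths.
\<close>

lemma wedge_norm_shear: "wedge_norm x (y - t *\<^sub>R x) = wedge_norm x y"
  by (simp add: wedge_norm_def algebra_simps)

lemma wedge_norm_eq_dist_to_line:
  assumes "x \<noteq> 0"
  obtains t where "wedge_norm x y = norm x * norm (y - t *\<^sub>R x)"
proof -
  define t where "t = (x \<bullet> y) / (x \<bullet> x)"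
  have "x \<bullet> (y - t *\<^sub>R x) = 0"
    using assms by (simp add: t_def inner_diff_right)
  then have "(wedge_norm x (y - t *\<^sub>R x))\<^sup>2 = (norm x * norm (y - t *\<^sub>R x))\<^sup>2"
    unfolding wedge_norm_squared by (simp add: power_mult_distrib)
  then have "wedge_norm x (y - t *\<^sub>R x) = norm x * norm (y - t *\<^sub>R x)"
    by (rule power2_eq_imp_eq) (simp_all add: wedge_norm_nonneg)
  then show thesis
    by (intro that) (simp only: wedge_norm_shear)
qed

lemma sin_angle_nonneg: "0 \<le> sin_angle x y"
  by (simp add: sin_angle_def wedge_norm_nonneg)

lemma sin_angle_le_1: "sin_angle x y \<le> 1"
  using wedge_norm_le[of x y] by (auto simp: sin_angle_def divide_le_eq_1 wedge_norm_nonneg)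

lemma sin_angle_self: "sin_angle x x = 0"
  by (simp add: sin_angle_def wedge_norm_def)

lemma sin_angle_scale:
  assumes "a \<noteq> 0" "b \<noteq> 0"
  shows "sin_angle (a *\<^sub>R x) (b *\<^sub>R y) = sin_angle x y"
  using assms by (simp add: sin_angle_def wedge_norm_scale)

lemma distortion_leD:
  assumes "distortion_le B g"
  shows "norm (g *v v) \<le> B * norm v" "norm v \<le> B * norm (g *v v)"
  using assms by (auto simp: distortion_le_def)

lemma distortion_le_nonzero:
  assumes "distortion_le B g" "v \<noteq> 0"
  shows "g *v v \<noteq> 0"
  using distortion_leD(2)[OF assms(1), of v] assms(2) by auto

text \<open>
  For an optimal shear the area of one parallelogram is the product of two lengths, and the
  corresponding shear of the other one bounds its area by the product of the two corresponding lengths.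
  Each length changes by a factor of at most \<open>B\<close>.
\<close>

lemma wedge_norm_distortion:
  assumes g: "distortion_le B g" and "0 \<le> B" "x \<noteq> 0"
  shows "wedge_norm (g *v x) (g *v y) \<le> B\<^sup>2 * wedge_norm x y"
    and "wedge_norm x y \<le> B\<^sup>2 * wedge_norm (g *v x) (g *v y)"
proof -
  have lin: "g *v y - t *\<^sub>R (g *v x) = g *v (y - t *\<^sub>R x)" for t
    by (simp add: matrix_vector_mult_diff_distrib matrix_vector_mult_scaleR)
  obtain t where t: "wedge_norm x y = norm x * norm (y - t *\<^sub>R x)"
    using wedge_norm_eq_dist_to_line[OF \<open>x \<noteq> 0\<close>] by blast
  have "wedge_norm (g *v x) (g *v y) \<le> norm (g *v x) * norm (g *v (y - t *\<^sub>R x))"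
    unfolding wedge_norm_shear[of "g *v x" "g *v y" t, symmetric] lin by (rule wedge_norm_le)
  also have "\<dots> \<le> (B * norm x) * (B * norm (y - t *\<^sub>R x))"
    using \<open>0 \<le> B\<close> by (intro mult_mono distortion_leD[OF g]) auto
  finally show "wedge_norm (g *v x) (g *v y) \<le> B\<^sup>2 * wedge_norm x y"
    by (simp add: t power2_eq_square mult_ac)
  \<comment> \<open>The optimal shear of the image parallelogram is the image of a shear by the same \<open>t\<close>.\<close>
  obtain t where t: "wedge_norm (g *v x) (g *v y) = norm (g *v x) * norm (g *v (y - t *\<^sub>R x))"
    using wedge_norm_eq_dist_to_line[OF distortion_le_nonzero[OF g \<open>x \<noteq> 0\<close>]] lin by metis
  have "wedge_norm x y \<le> norm x * norm (y - t *\<^sub>R x)"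
    unfolding wedge_norm_shear[of x y t, symmetric] by (rule wedge_norm_le)
  also have "\<dots> \<le> (B * norm (g *v x)) * (B * norm (g *v (y - t *\<^sub>R x)))"
    using \<open>0 \<le> B\<close> by (intro mult_mono distortion_leD[OF g]) auto
  finally show "wedge_norm x y \<le> B\<^sup>2 * wedge_norm (g *v x) (g *v y)"
    by (simp add: t power2_eq_square mult_ac)
qed

text \<open>
  Two factors \<open>B\<close> come from the area and two from the lengths of the sides.
\<close>

lemma sin_angle_distortion:
  assumes g: "distortion_le B g" and "0 \<le> B" "x \<noteq> 0" "y \<noteq> 0"
  shows "sin_angle (g *v x) (g *v y) \<le> B^4 * sin_angle x y"
    and "sin_angle x y \<le> B^4 * sin_angle (g *v x) (g *v y)"
proof -
  note nz = distortion_le_nonzero[OF g]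
  have 1: "norm x * norm y \<le> B\<^sup>2 * (norm (g *v x) * norm (g *v y))"
    using mult_mono[OF distortion_leD(2)[OF g, of x] distortion_leD(2)[OF g, of y]] \<open>0 \<le> B\<close>
    by (simp add: power2_eq_square mult_ac)
  have 2: "norm (g *v x) * norm (g *v y) \<le> B\<^sup>2 * (norm x * norm y)"
    using mult_mono[OF distortion_leD(1)[OF g, of x] distortion_leD(1)[OF g, of y]] \<open>0 \<le> B\<close>
    by (simp add: power2_eq_square mult_ac)
  have pos: "0 < norm x * norm y" "0 < norm (g *v x) * norm (g *v y)"
    using assms nz by auto
  have cross: "a / p \<le> B^4 * (b / q)" if "a * q \<le> (B\<^sup>2 * b) * (B\<^sup>2 * p)" "0 < p" "0 < q" for a b p q
  proof -
    have "a \<le> B^4 * b * p / q"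
      using that by (simp add: pos_le_divide_eq power2_eq_square power4_eq_xxxx mult_ac)
    then show ?thesis
      using that by (simp add: pos_divide_le_eq)
  qed
  have "wedge_norm (g *v x) (g *v y) * (norm x * norm y)
      \<le> (B\<^sup>2 * wedge_norm x y) * (B\<^sup>2 * (norm (g *v x) * norm (g *v y)))"
    by (intro mult_mono wedge_norm_distortion[OF g] 1) (use assms in \<open>auto simp: wedge_norm_nonneg\<close>)
  then show "sin_angle (g *v x) (g *v y) \<le> B^4 * sin_angle x y"
    unfolding sin_angle_def using pos by (intro cross)
  have "wedge_norm x y * (norm (g *v x) * norm (g *v y))
      \<le> (B\<^sup>2 * wedge_norm (g *v x) (g *v y)) * (B\<^sup>2 * (norm x * norm y))"
    by (intro mult_mono wedge_norm_distortion[OF g] 2) (use assms in \<open>auto simp: wedge_norm_nonneg\<close>)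
  then show "sin_angle x y \<le> B^4 * sin_angle (g *v x) (g *v y)"
    unfolding sin_angle_def using pos by (intro cross)
qed

text \<open>
  When the angle is at most a right one, \<open>\<parallel>u - v\<parallel>\<^sup>2 = 2 (1 - cos) \<le> 2 (1 - cos\<^sup>2)\<close>.
\<close>

lemma norm_diff_le_sin_angle:
  assumes "norm u = 1" "norm v = 1" "0 \<le> u \<bullet> v"
  shows "norm (u - v) \<le> 2 * sin_angle u v"
proof (rule power2_le_imp_le)
  have 1: "(sin_angle u v)\<^sup>2 = 1 - (u \<bullet> v)\<^sup>2"
    using assms by (simp add: sin_angle_def wedge_norm_squared)
  have "u \<bullet> v \<le> 1"
    using norm_cauchy_schwarz[of u v] assms by simp
  then have 2: "(u \<bullet> v)\<^sup>2 \<le> u \<bullet> v"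
    using assms by (simp add: power2_eq_square mult_left_le)
  have "(norm (u - v))\<^sup>2 = 2 - 2 * (u \<bullet> v)"
    using assms by (simp add: power2_norm_eq_inner inner_diff inner_commute norm_eq_1)
  then show "(norm (u - v))\<^sup>2 \<le> (2 * sin_angle u v)\<^sup>2"
    using 1 2 \<open>u \<bullet> v \<le> 1\<close> by (simp add: power_mult_distrib)
qed (simp add: sin_angle_nonneg)

lemma ln_norm_diff_distortion:
  assumes g: "distortion_le B g" and "0 \<le> B" "norm u = 1" "norm v = 1"
  shows "ln (norm (g *v u)) - ln (norm (g *v v)) \<le> B\<^sup>2 * norm (u - v)"
proof -
  have nz: "g *v u \<noteq> 0" "g *v v \<noteq> 0"
    by (rule distortion_le_nonzero[OF g]; use assms in force)+
  have "ln (norm (g *v u)) - ln (norm (g *v v)) \<le> (norm (g *v u) - norm (g *v v)) / norm (g *v v)"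
    using nz by (intro ln_diff_le) auto
  also have "\<dots> \<le> norm (g *v (u - v)) * (1 / norm (g *v v))"
    using norm_triangle_ineq2[of "g *v u" "g *v v"]
    by (simp add: divide_right_mono matrix_vector_mult_diff_distrib)
  also have "\<dots> \<le> (B * norm (u - v)) * B"
  proof (rule mult_mono)
    show "1 / norm (g *v v) \<le> B"
      using distortion_leD(2)[OF g, of v] nz assms by (simp add: divide_le_eq)
  qed (use \<open>0 \<le> B\<close> distortion_leD(1)[OF g] in auto)
  finally show ?thesis
    by (simp add: power2_eq_square mult_ac)
qed

lemma cocycle_scale: "a \<noteq> 0 \<Longrightarrow> cocycle g (a *\<^sub>R y) = cocycle g y"
  by (simp add: cocycle_def matrix_vector_mult_scaleR)

text \<open>
  The cocycle depends only on the lines spanned by its arguments, so these may be replaced by unit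
  vectors, one of them with its sign chosen such that the angle is at most a right one; there the chord
  length is controlled by the sine.
\<close>

lemma cocycle_lipschitz:
  assumes g: "distortion_le B g" and "0 \<le> B" "x \<noteq> 0" "y \<noteq> 0"
  shows "\<bar>cocycle g x - cocycle g y\<bar> \<le> 2 * B\<^sup>2 * sin_angle x y"
proof -
  define b where "b = (if 0 \<le> x \<bullet> y then 1 / norm y else - 1 / norm y)"
  define u where "u = (1 / norm x) *\<^sub>R x"
  define v where "v = b *\<^sub>R y"
  have nz: "1 / norm x \<noteq> 0" "b \<noteq> 0"
    using assms by (auto simp: b_def)
  have uv: "norm u = 1" "norm v = 1" "0 \<le> u \<bullet> v"
    using assms by (auto simp: u_def v_def b_def divide_nonpos_pos)
  have sin: "norm (u - v) \<le> 2 * sin_angle x y"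
    using norm_diff_le_sin_angle[OF uv] unfolding u_def v_def sin_angle_scale[OF nz] .
  have "cocycle g x - cocycle g y = ln (norm (g *v u)) - ln (norm (g *v v))"
    unfolding cocycle_scale[OF nz(1), symmetric, of g x] cocycle_scale[OF nz(2), symmetric, of g y]
    unfolding u_def[symmetric] v_def[symmetric] by (simp add: cocycle_def uv)
  moreover have "B\<^sup>2 * norm (u - v) \<le> 2 * B\<^sup>2 * sin_angle x y"
    using mult_left_mono[OF sin, of "B\<^sup>2"] by simp
  ultimately show ?thesis
    using ln_norm_diff_distortion[OF g \<open>0 \<le> B\<close> uv(1,2)]
      ln_norm_diff_distortion[OF g \<open>0 \<le> B\<close> uv(2,1)] norm_minus_commute[of u v]
    by (simp add: abs_le_iff)
qed

lemma cocycle_bounded: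
  assumes g: "distortion_le B g" and "1 \<le> B" "x \<noteq> 0"
  shows "\<bar>cocycle g x\<bar> \<le> ln B"
proof -
  have "0 < norm (g *v x)" "0 < norm x"
    using assms distortion_le_nonzero[OF g] by auto
  then have "norm (g *v x) / norm x \<le> B" "1 / B \<le> norm (g *v x) / norm x" "0 < norm (g *v x) / norm x"
    using distortion_leD[OF g, of x] assms by (auto simp: field_simps)
  then have "ln (norm (g *v x) / norm x) \<le> ln B" "ln (1 / B) \<le> ln (norm (g *v x) / norm x)"
    using \<open>1 \<le> B\<close> by (intro ln_mono; simp)+
  moreover have "ln (1 / B) = - ln B"
    using \<open>1 \<le> B\<close> by (simp add: ln_div)
  ultimately show ?thesis
    by (simp add: cocycle_def abs_le_iff)
qed

lemma distortion_le_mat_N: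
  assumes "invertible g" "mat_N g \<le> B"
  shows "distortion_le B g"
proof -
  have bl: "bounded_linear (\<lambda>v. g *v v)" "bounded_linear (\<lambda>v. matrix_inv g *v v)"
    by auto
  have *: "onorm (\<lambda>v. g *v v) \<le> B" "onorm (\<lambda>v. matrix_inv g *v v) \<le> B"
    using assms by (auto simp: mat_N_def)
  have "norm (g *v v) \<le> B * norm v" for v
    using onorm[OF bl(1), of v] mult_right_mono[OF *(1), of "norm v"] by simp
  moreover have "norm v \<le> B * norm (g *v v)" for v
  proof -
    have "matrix_inv g ** g = mat 1"
      using assms(1) unfolding invertible_def matrix_inv_def by (metis (mono_tags, lifting) someI_ex)
    then have "matrix_inv g *v (g *v v) = v"
      by (simp add: matrix_vector_mul_assoc)
    then show ?thesis
      using onorm[OF bl(2), of "g *v v"] mult_right_mono[OF *(2), of "norm (g *v v)"] by simp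
  qed
  ultimately show ?thesis
    by (simp add: distortion_le_def)
qed

section \<open>Products of matrices\<close>

lemma distortion_le_mult:
  assumes "distortion_le B g" "distortion_le C h" "0 \<le> B" "0 \<le> C"
  shows "distortion_le (B * C) (g ** h)"
  unfolding distortion_le_def matrix_vector_mul_assoc[symmetric]
proof (intro allI conjI)
  fix v
  show "norm (g *v (h *v v)) \<le> B * C * norm v"
    using order_trans[OF distortion_leD(1)[OF assms(1)]
        mult_left_mono[OF distortion_leD(1)[OF assms(2), of v] \<open>0 \<le> B\<close>]]
    by (simp add: mult_ac)
  show "norm v \<le> B * C * norm (g *v (h *v v))"
    using order_trans[OF distortion_leD(2)[OF assms(2), of v]
        mult_left_mono[OF distortion_leD(2)[OF assms(1), of "h *v v"] \<open>0 \<le> C\<close>]]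
    by (simp add: mult_ac)
qed

lemma distortion_le_mat_prod:
  assumes "\<And>i. j \<le> i \<Longrightarrow> i < j + n \<Longrightarrow> distortion_le B (h i)" "0 \<le> B"
  shows "distortion_le (B ^ n) (mat_prod h j n)"
  using assms(1)
proof (induction n)
  case 0
  then show ?case by (simp add: distortion_le_def)
next
  case (Suc n)
  then show ?case
    using distortion_le_mult[of B "h (j + n)" "B ^ n"] \<open>0 \<le> B\<close> by simp
qed

lemma mat_prod_add: "mat_prod h j (m + n) = mat_prod h (j + m) n ** mat_prod h j m"
  by (induction n) (simp_all add: matrix_mul_assoc add_ac)

lemma mat_prod_cong:
  assumes "\<And>i. j \<le> i \<Longrightarrow> i < j + n \<Longrightarrow> h i = h' i"
  shows "mat_prod h j n = mat_prod h' j n"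
  using assms by (induction n) auto

lemma invertible_mat_prod:
  assumes "\<And>i. j \<le> i \<Longrightarrow> i < j + n \<Longrightarrow> invertible (h i)"
  shows "invertible (mat_prod h j n :: real^'n^'n)"
proof -
  have "invertible (mat 1 :: real^'n^'n)"
    unfolding invertible_def by (rule exI[of _ "mat 1"]) simp
  with assms show ?thesis
    by (induction n) (auto intro: invertible_mult)
qed

section \<open>Measurability\<close>

lemma borel_measurable_matrix_mult:
  fixes f g :: "'w \<Rightarrow> real^'n^'n"
  assumes "f \<in> borel_measurable M" "g \<in> borel_measurable M"
  shows "(\<lambda>\<omega>. f \<omega> ** g \<omega>) \<in> borel_measurable M"
  using assms
  by (rule borel_measurable_continuous_Pair)
    (unfold matrix_matrix_mult_def, intro continuous_intros)

lemma borel_measurable_matrix_vector_mult: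
  fixes f :: "'w \<Rightarrow> real^'n^'n" and g :: "'w \<Rightarrow> real^'n"
  assumes "f \<in> borel_measurable M" "g \<in> borel_measurable M"
  shows "(\<lambda>\<omega>. f \<omega> *v g \<omega>) \<in> borel_measurable M"
  using assms
  by (rule borel_measurable_continuous_Pair)
    (unfold matrix_vector_mult_def, intro continuous_intros)

lemma borel_measurable_sin_angle:
  fixes f g :: "'w \<Rightarrow> real^'n"
  assumes [measurable]: "f \<in> borel_measurable M" "g \<in> borel_measurable M"
  shows "(\<lambda>\<omega>. sin_angle (f \<omega>) (g \<omega>)) \<in> borel_measurable M"
proof -
  have "(\<lambda>\<omega>. wedge_norm (f \<omega>) (g \<omega>)) \<in> borel_measurable M"
    using assms
    by (rule borel_measurable_continuous_Pair)
      (unfold wedge_norm_def, intro continuous_intros, simp)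
  then show ?thesis
    unfolding sin_angle_def by measurable
qed

lemma borel_measurable_mat_prod:
  assumes "\<And>i. j \<le> i \<Longrightarrow> i < j + n \<Longrightarrow> h i \<in> borel_measurable M"
  shows "(\<lambda>\<omega>. mat_prod (\<lambda>i. h i \<omega>) j n) \<in> borel_measurable M"
  using assms by (induction n) (auto intro!: borel_measurable_matrix_mult)

lemma borel_measurable_cocycle:
  fixes f :: "'w \<Rightarrow> real^'n^'n" and g :: "'w \<Rightarrow> real^'n"
  assumes [measurable]: "f \<in> borel_measurable M" "g \<in> borel_measurable M"
  shows "(\<lambda>\<omega>. cocycle (f \<omega>) (g \<omega>)) \<in> borel_measurable M"
proof -
  note borel_measurable_matrix_vector_mult[OF assms, measurable]
  show ?thesis unfolding cocycle_def by measurable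
qed

section \<open>From contraction in the mean logarithm to contraction of a moment\<close>

text \<open>
  For \<open>z = - x < 0\<close> the claim is \<open>1 \<le> (1 - x + x\<^sup>2) exp x\<close>, which follows from the quadratic Taylor
  minorant of \<open>exp x\<close>.
\<close>

lemma exp_le_quadratic:
  fixes z :: real
  assumes "\<bar>z\<bar> \<le> 1"
  shows "exp z \<le> 1 + z + z\<^sup>2"
proof (cases "0 \<le> z")
  case True
  then show ?thesis using exp_bound[of z] assms by simp
next
  case False
  define x where "x = - z"
  have x: "0 \<le> x" using False by (simp add: x_def)
  have "1 \<le> (1 - x + x\<^sup>2) * (1 + x + x\<^sup>2 / 2)"
  proof -
    have "(1 - x + x\<^sup>2) * (1 + x + x\<^sup>2 / 2) = 1 + x^2 / 2 + x^3 / 2 + x^4 / 2"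
      by (simp add: field_simps power2_eq_square power3_eq_cube power4_eq_xxxx)
    then show ?thesis using x by simp
  qed
  also have "\<dots> \<le> (1 - x + x\<^sup>2) * exp x"
  proof (rule mult_left_mono)
    show "0 \<le> 1 - x + x\<^sup>2" using assms False by (simp add: x_def)
  qed (rule exp_lower_Taylor_quadratic[OF x])
  finally show ?thesis
    by (simp add: x_def exp_minus field_simps)
qed

text \<open>
  By the quadratic bound on the exponential, the moment is at most \<open>1 - s \<delta> + s\<^sup>2 K\<^sup>2\<close>, and the choice of
  \<open>s\<close> makes the last term at most half of the middle one.
\<close>

lemma (in prob_space) exp_moment_of_negative_mean:
  fixes U :: "'a \<Rightarrow> real"
  assumes [measurable]: "U \<in> borel_measurable M"
    and bd: "AE \<omega> in M. \<bar>U \<omega>\<bar> \<le> K"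
    and mean: "expectation U \<le> - \<delta>"
    and s: "0 \<le> s" "s * K \<le> 1" "s * K\<^sup>2 \<le> \<delta> / 2"
  shows "(\<integral>\<^sup>+\<omega>. ennreal (exp (s * U \<omega>)) \<partial>M) \<le> ennreal (1 - s * \<delta> / 2)"
proof -
  have intU: "integrable M U"
    using bd by (intro integrable_const_bound[where B = K]) auto
  have ineq: "AE \<omega> in M. exp (s * U \<omega>) \<le> 1 + s * U \<omega> + s\<^sup>2 * K\<^sup>2"
    using bd
  proof eventually_elim
    case (elim \<omega>)
    have "\<bar>s * U \<omega>\<bar> \<le> s * K"
      using elim s(1) by (simp add: abs_mult mult_left_mono)
    then have 1: "\<bar>s * U \<omega>\<bar> \<le> 1" and "(s * U \<omega>)\<^sup>2 \<le> (s * K)\<^sup>2"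
      using s(2) by (auto simp: abs_le_square_iff[symmetric])
    with exp_le_quadratic[OF 1] show ?case
      by (simp add: power_mult_distrib)
  qed
  have "(\<integral>\<^sup>+\<omega>. ennreal (exp (s * U \<omega>)) \<partial>M) \<le> (\<integral>\<^sup>+\<omega>. ennreal (1 + s * U \<omega> + s\<^sup>2 * K\<^sup>2) \<partial>M)"
    using ineq by (intro nn_integral_mono_AE) (auto intro: ennreal_leI)
  also have "\<dots> = ennreal (\<integral>\<omega>. 1 + s * U \<omega> + s\<^sup>2 * K\<^sup>2 \<partial>M)"
  proof (rule nn_integral_eq_integral)
    show "AE \<omega> in M. 0 \<le> 1 + s * U \<omega> + s\<^sup>2 * K\<^sup>2"
      using ineq by eventually_elim (use exp_ge_zero order_trans in blast)
  qed (use intU in auto)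
  also have "(\<integral>\<omega>. 1 + s * U \<omega> + s\<^sup>2 * K\<^sup>2 \<partial>M) = 1 + s * expectation U + s\<^sup>2 * K\<^sup>2"
    using intU by (simp add: prob_space)
  also have "\<dots> \<le> 1 - s * \<delta> / 2"
    using mult_left_mono[OF mean s(1)] mult_left_mono[OF s(3) s(1)]
    by (simp add: power2_eq_square mult_ac)
  finally show ?thesis
    by (simp add: ennreal_leI)
qed

text \<open>
  The logarithm of the ratio of the sines is bounded because the distortion is, so the preceding lemma
  applies to it. If the two lines coincide there is no ratio, but then their images coincide as well.
\<close>

lemma (in prob_space) sin_angle_moment_contraction:
  fixes G :: "'a \<Rightarrow> real^'n^'n" and x y :: "real^'n"
  assumes [measurable]: "G \<in> borel_measurable M"
    and dist: "AE \<omega> in M. distortion_le C (G \<omega>)" and C: "1 \<le> C"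
    and nz: "x \<noteq> 0" "y \<noteq> 0"
    and mean: "sin_angle x y \<noteq> 0 \<Longrightarrow>
      expectation (\<lambda>\<omega>. ln (sin_angle (G \<omega> *v x) (G \<omega> *v y) / sin_angle x y)) \<le> - \<delta>"
    and s: "0 < s" "s * ln (C^4) \<le> 1" "s * (ln (C^4))\<^sup>2 \<le> \<delta> / 2"
  shows "(\<integral>\<^sup>+\<omega>. ennreal (sin_angle (G \<omega> *v x) (G \<omega> *v y) powr s) \<partial>M)
    \<le> ennreal (1 - s * \<delta> / 2) * ennreal (sin_angle x y powr s)"
proof (cases "sin_angle x y = 0")
  case True
  have "AE \<omega> in M. sin_angle (G \<omega> *v x) (G \<omega> *v y) = 0"
    using dist
  proof eventually_elim
    case (elim \<omega>)
    then show ?case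
      using sin_angle_distortion(1)[OF elim _ nz] C sin_angle_nonneg[of "G \<omega> *v x" "G \<omega> *v y"]
      by (simp add: True)
  qed
  then have "(\<integral>\<^sup>+\<omega>. ennreal (sin_angle (G \<omega> *v x) (G \<omega> *v y) powr s) \<partial>M) = (\<integral>\<^sup>+\<omega>. 0 \<partial>M)"
    by (intro nn_integral_cong_AE) auto
  then show ?thesis by simp
next
  case False
  define t where "t = sin_angle x y"
  have t: "0 < t"
    using False sin_angle_nonneg[of x y] by (simp add: t_def)
  define U where "U \<omega> = ln (sin_angle (G \<omega> *v x) (G \<omega> *v y) / t)" for \<omega>
  have [measurable]: "(\<lambda>\<omega>. sin_angle (G \<omega> *v x) (G \<omega> *v y)) \<in> borel_measurable M"
    by (intro borel_measurable_sin_angle borel_measurable_matrix_vector_mult) auto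
  have [measurable]: "U \<in> borel_measurable M"
    unfolding U_def by measurable
  have *: "AE \<omega> in M. 0 < sin_angle (G \<omega> *v x) (G \<omega> *v y) \<and> \<bar>U \<omega>\<bar> \<le> ln (C^4)"
    using dist
  proof eventually_elim
    case (elim \<omega>)
    define t' where "t' = sin_angle (G \<omega> *v x) (G \<omega> *v y)"
    have le: "t' \<le> C^4 * t" "t \<le> C^4 * t'"
      using sin_angle_distortion[OF elim _ nz] C by (auto simp: t_def t'_def)
    have "t' \<noteq> 0"
      using t le by auto
    then have t': "0 < t'"
      using sin_angle_nonneg[of "G \<omega> *v x" "G \<omega> *v y"] by (simp add: t'_def)
    have "ln t' \<le> ln (C^4 * t)" "ln t \<le> ln (C^4 * t')"
      using le t t' by (auto intro: ln_mono)
    then have "ln t' \<le> ln (C^4) + ln t" "ln t \<le> ln (C^4) + ln t'"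
      using t t' C by (auto simp: ln_mult)
    moreover have "U \<omega> = ln t' - ln t"
      using t t' by (simp add: U_def t'_def ln_div)
    ultimately show ?case
      using t' unfolding t'_def by linarith
  qed
  then have "(\<integral>\<^sup>+\<omega>. ennreal (sin_angle (G \<omega> *v x) (G \<omega> *v y) powr s) \<partial>M)
      = (\<integral>\<^sup>+\<omega>. ennreal (exp (s * U \<omega>)) * ennreal (t powr s) \<partial>M)"
  proof (intro nn_integral_cong_AE, eventually_elim)
    case (elim \<omega>)
    then show ?case
      using t by (simp add: U_def powr_def ln_div algebra_simps flip: ennreal_mult exp_add)
  qed
  also have "\<dots> = (\<integral>\<^sup>+\<omega>. ennreal (exp (s * U \<omega>)) \<partial>M) * ennreal (t powr s)"
    by (rule nn_integral_multc) measurable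
  also have "\<dots> \<le> ennreal (1 - s * \<delta> / 2) * ennreal (t powr s)"
  proof (intro mult_right_mono exp_moment_of_negative_mean)
    show "expectation U \<le> - \<delta>"
      using mean[OF False] by (simp add: U_def[abs_def] t_def)
  qed (use * s in auto)
  finally show ?thesis
    by (simp add: t_def)
qed

text \<open>
  Fubini for the joint law, which independence makes a product.
\<close>

lemma (in prob_space) nn_integral_indep_var:
  assumes ind: "indep_var N1 X N2 Y"
    and [measurable]: "f \<in> borel_measurable (N1 \<Otimes>\<^sub>M N2)"
  shows "(\<integral>\<^sup>+\<omega>. f (X \<omega>, Y \<omega>) \<partial>M) = (\<integral>\<^sup>+\<omega>. (\<integral>\<^sup>+\<omega>'. f (X \<omega>, Y \<omega>') \<partial>M) \<partial>M)"
proof -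
  have [measurable]: "X \<in> M \<rightarrow>\<^sub>M N1" "Y \<in> M \<rightarrow>\<^sub>M N2"
    using ind by (auto dest: indep_var_rv1 indep_var_rv2)
  interpret Y: prob_space "distr M N2 Y"
    by (rule prob_space_distr) simp
  have "(\<integral>\<^sup>+\<omega>. f (X \<omega>, Y \<omega>) \<partial>M) = (\<integral>\<^sup>+z. f z \<partial>distr M (N1 \<Otimes>\<^sub>M N2) (\<lambda>\<omega>. (X \<omega>, Y \<omega>)))"
    by (simp add: nn_integral_distr)
  also have "\<dots> = (\<integral>\<^sup>+z. f z \<partial>(distr M N1 X \<Otimes>\<^sub>M distr M N2 Y))"
    using ind by (simp add: indep_var_distribution_eq)
  also have "\<dots> = (\<integral>\<^sup>+u. (\<integral>\<^sup>+v. f (u, v) \<partial>distr M N2 Y) \<partial>distr M N1 X)"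
    by (rule Y.nn_integral_fst[symmetric]) simp
  also have "\<dots> = (\<integral>\<^sup>+\<omega>. (\<integral>\<^sup>+v. f (X \<omega>, v) \<partial>distr M N2 Y) \<partial>M)"
    by (simp add: nn_integral_distr)
  also have "\<dots> = (\<integral>\<^sup>+\<omega>. (\<integral>\<^sup>+\<omega>'. f (X \<omega>, Y \<omega>') \<partial>M) \<partial>M)"
  proof (rule nn_integral_cong)
    fix \<omega> assume "\<omega> \<in> space M"
    then have "X \<omega> \<in> space N1"
      by (rule measurable_space[of X M N1, rotated]) simp
    then show "(\<integral>\<^sup>+v. f (X \<omega>, v) \<partial>distr M N2 Y) = (\<integral>\<^sup>+\<omega>'. f (X \<omega>, Y \<omega>') \<partial>M)"
      by (intro nn_integral_distr) measurable
  qed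
  finally show ?thesis .
qed

text \<open>
  A contraction that holds for every fixed pair of lines holds for random pairs independent of the
  matrix, by conditioning on the pair. The vectors and the matrix appear as functions of two
  independent variables \<open>X\<close> and \<open>Y\<close> of one type, which will be the past and the next block of the sequence.
\<close>

lemma (in prob_space) sin_angle_moment_contraction_indep:
  fixes G :: "'b \<Rightarrow> real^'n^'n" and u v :: "'b \<Rightarrow> real^'n" and X Y :: "'a \<Rightarrow> 'b"
  assumes ind: "indep_var N1 X N2 Y"
    and meas: "u \<in> borel_measurable N1" "v \<in> borel_measurable N1" "G \<in> borel_measurable N2"
    and nz: "AE \<omega> in M. u (X \<omega>) \<noteq> 0 \<and> v (X \<omega>) \<noteq> 0"
    and contr: "\<And>x y. x \<noteq> 0 \<Longrightarrow> y \<noteq> 0 \<Longrightarrow>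
      (\<integral>\<^sup>+\<omega>. ennreal (sin_angle (G (Y \<omega>) *v x) (G (Y \<omega>) *v y) powr s) \<partial>M)
      \<le> c * ennreal (sin_angle x y powr s)"
  shows "(\<integral>\<^sup>+\<omega>. ennreal (sin_angle (G (Y \<omega>) *v u (X \<omega>)) (G (Y \<omega>) *v v (X \<omega>)) powr s) \<partial>M)
    \<le> c * (\<integral>\<^sup>+\<omega>. ennreal (sin_angle (u (X \<omega>)) (v (X \<omega>)) powr s) \<partial>M)"
proof -
  have X [measurable]: "X \<in> M \<rightarrow>\<^sub>M N1"
    using ind by (rule indep_var_rv1)
  define f where "f = (\<lambda>z. ennreal (sin_angle (G (snd z) *v u (fst z)) (G (snd z) *v v (fst z)) powr s))"
  have [measurable]: "(\<lambda>z. sin_angle (G (snd z) *v u (fst z)) (G (snd z) *v v (fst z)))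
      \<in> borel_measurable (N1 \<Otimes>\<^sub>M N2)"
    by (intro borel_measurable_sin_angle borel_measurable_matrix_vector_mult
        measurable_compose[OF measurable_fst] measurable_compose[OF measurable_snd] meas)
  have f: "f \<in> borel_measurable (N1 \<Otimes>\<^sub>M N2)"
    unfolding f_def by measurable
  have uv [measurable]: "(\<lambda>\<omega>. sin_angle (u (X \<omega>)) (v (X \<omega>))) \<in> borel_measurable M"
    by (intro borel_measurable_sin_angle measurable_compose[OF X] meas)
  have "(\<integral>\<^sup>+\<omega>. f (X \<omega>, Y \<omega>) \<partial>M) = (\<integral>\<^sup>+\<omega>. (\<integral>\<^sup>+\<omega>'. f (X \<omega>, Y \<omega>') \<partial>M) \<partial>M)"
    by (rule nn_integral_indep_var[OF ind f])
  also have "\<dots> \<le> (\<integral>\<^sup>+\<omega>. c * ennreal (sin_angle (u (X \<omega>)) (v (X \<omega>)) powr s) \<partial>M)"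
    using nz by (intro nn_integral_mono_AE, eventually_elim) (simp add: f_def contr)
  also have "\<dots> = c * (\<integral>\<^sup>+\<omega>. ennreal (sin_angle (u (X \<omega>)) (v (X \<omega>)) powr s) \<partial>M)"
    by (intro nn_integral_cmult) measurable
  finally show ?thesis
    by (simp add: f_def)
qed

text \<open>
  The two vectors compared are driven by the same matrices from time \<open>j\<close> on, but the first has
  already been moved by \<open>g\<^sub>1, \<dots>, g\<^sub>j\<^sub>-\<^sub>1\<close> by then. Peeling off the last \<open>n\<close> matrices,
  which are independent of everything before, gives one factor \<open>c\<close>; fewer than \<open>n\<close> remaining steps are
  absorbed by the bound \<open>1\<close> on the sine, whence the exponent \<open>r div n\<close>.
\<close>

lemma (in prob_space) sin_angle_moment_decay:
  fixes g :: "nat \<Rightarrow> 'a \<Rightarrow> real^'n^'n" and x y :: "real^'n"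
  assumes ind: "indep_vars (\<lambda>_. borel) g {1..}"
    and dist: "AE \<omega> in M. \<forall>j\<ge>1. distortion_le B (g j \<omega>)" and B: "1 \<le> B"
    and contr: "\<And>j x y. 1 \<le> j \<Longrightarrow> x \<noteq> 0 \<Longrightarrow> y \<noteq> 0 \<Longrightarrow>
      (\<integral>\<^sup>+\<omega>. ennreal (sin_angle (mat_prod (\<lambda>i. g i \<omega>) j n *v x) (mat_prod (\<lambda>i. g i \<omega>) j n *v y) powr s) \<partial>M)
      \<le> c * ennreal (sin_angle x y powr s)"
    and nz: "x \<noteq> 0" "y \<noteq> 0" and "1 \<le> n" "0 < s" "1 \<le> j"
  shows "(\<integral>\<^sup>+\<omega>. ennreal (sin_angle (mat_prod (\<lambda>i. g i \<omega>) 1 (j - 1 + r) *v x)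
             (mat_prod (\<lambda>i. g i \<omega>) j r *v y) powr s) \<partial>M) \<le> c ^ (r div n)"
proof (induction r rule: less_induct)
  case (less r)
  show ?case
  proof (cases "r < n")
    case True
    have "(\<integral>\<^sup>+\<omega>. ennreal (sin_angle (mat_prod (\<lambda>i. g i \<omega>) 1 (j - 1 + r) *v x)
             (mat_prod (\<lambda>i. g i \<omega>) j r *v y) powr s) \<partial>M) \<le> (\<integral>\<^sup>+\<omega>. 1 \<partial>M)"
      using \<open>0 < s\<close>
      by (intro nn_integral_mono) (auto intro!: powr_le1 simp: sin_angle_nonneg sin_angle_le_1)
    then show ?thesis
      using True by (simp add: emeasure_space_1)
  next
    case False
    define q where "q = r - n"
    have r: "r = q + n" and "q < r"
      using False \<open>1 \<le> n\<close> by (auto simp: q_def)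
    \<comment> \<open>Independence concerns the restrictions of the sequence to disjoint sets of times, so the vectors and
      the block are written as functions of these restrictions.\<close>
    let ?past = "{1..<j + q}" and ?block = "{j + q..<j + q + n}"
    let ?P = "\<lambda>S. PiM S (\<lambda>_. borel :: (real^'n^'n) measure)"
    let ?X = "\<lambda>\<omega>. \<lambda>i\<in>?past. g i \<omega>" and ?Y = "\<lambda>\<omega>. \<lambda>i\<in>?block. g i \<omega>"
    define u where "u h = mat_prod h 1 (j - 1 + q) *v x" for h
    define v where "v h = mat_prod h j q *v y" for h
    define G where "G h = mat_prod h (j + q) n" for h :: "nat \<Rightarrow> real^'n^'n"
    have meas: "(\<lambda>h. mat_prod h i m) \<in> borel_measurable (?P S)" if "{i..<i + m} \<subseteq> S" for i m S
      using that by (intro borel_measurable_mat_prod measurable_component_singleton) auto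
    have meas_uvG: "u \<in> borel_measurable (?P ?past)" "v \<in> borel_measurable (?P ?past)"
      "G \<in> borel_measurable (?P ?block)"
      unfolding u_def v_def G_def using \<open>1 \<le> j\<close>
      by (intro borel_measurable_matrix_vector_mult meas borel_measurable_const; auto)+
    have indep: "indep_var (?P ?past) ?X (?P ?block) ?Y"
      using \<open>1 \<le> j\<close> by (intro indep_var_restrict[OF ind]) auto
    have restr: "u (?X \<omega>) = u (\<lambda>i. g i \<omega>)" "v (?X \<omega>) = v (\<lambda>i. g i \<omega>)" "G (?Y \<omega>) = G (\<lambda>i. g i \<omega>)" for \<omega>
      unfolding u_def v_def G_def using \<open>1 \<le> j\<close>
      by (auto intro!: arg_cong2[where f = "(*v)"] mat_prod_cong)
    have nz_uv: "AE \<omega> in M. u (?X \<omega>) \<noteq> 0 \<and> v (?X \<omega>) \<noteq> 0"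
      using dist
    proof eventually_elim
      case (elim \<omega>)
      have *: "mat_prod (\<lambda>i. g i \<omega>) i m *v v \<noteq> 0" if "1 \<le> i" "v \<noteq> 0" for i m v
        using elim that B
        by (intro distortion_le_nonzero[of "B ^ m"] distortion_le_mat_prod) auto
      show ?case
        using *[OF _ nz(1)] *[OF \<open>1 \<le> j\<close> nz(2)] unfolding restr by (simp add: u_def v_def)
    qed
    have eq: "mat_prod (\<lambda>i. g i \<omega>) 1 (j - 1 + r) *v x = G (?Y \<omega>) *v u (?X \<omega>)"
      "mat_prod (\<lambda>i. g i \<omega>) j r *v y = G (?Y \<omega>) *v v (?X \<omega>)" for \<omega>
      using mat_prod_add[of "\<lambda>i. g i \<omega>" 1 "j - 1 + q" n] mat_prod_add[of "\<lambda>i. g i \<omega>" j q n] \<open>1 \<le> j\<close>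
      unfolding restr by (auto simp: r G_def u_def v_def matrix_vector_mul_assoc add.assoc)
    have "(\<integral>\<^sup>+\<omega>. ennreal (sin_angle (G (?Y \<omega>) *v u (?X \<omega>)) (G (?Y \<omega>) *v v (?X \<omega>)) powr s) \<partial>M)
        \<le> c * (\<integral>\<^sup>+\<omega>. ennreal (sin_angle (u (?X \<omega>)) (v (?X \<omega>)) powr s) \<partial>M)"
    proof (rule sin_angle_moment_contraction_indep[where X = ?X and Y = ?Y and u = u and v = v and G = G,
          OF indep meas_uvG nz_uv])
      fix x y :: "real^'n" assume "x \<noteq> 0" "y \<noteq> 0"
      then show "(\<integral>\<^sup>+\<omega>. ennreal (sin_angle (G (?Y \<omega>) *v x) (G (?Y \<omega>) *v y) powr s) \<partial>M)
          \<le> c * ennreal (sin_angle x y powr s)"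
        using contr[of "j + q"] \<open>1 \<le> j\<close> unfolding restr by (simp add: G_def)
    qed
    also have "\<dots> \<le> c * c ^ (q div n)"
      unfolding restr unfolding u_def v_def by (intro mult_left_mono less[OF \<open>q < r\<close>]) auto
    also have "\<dots> = c ^ (r div n)"
      using \<open>1 \<le> n\<close> by (simp add: r)
    finally show ?thesis
      by (simp only: eq)
  qed
qed

section \<open>Conditional expectations and norms\<close>

lemma subalgebra_gen_algebra:
  assumes "\<And>i. i \<in> I \<Longrightarrow> h i \<in> borel_measurable M"
  shows "subalgebra M (gen_algebra M h I)"
proof -
  have "(\<Union>i\<in>I. {h i -` B \<inter> space M | B. B \<in> sets borel}) \<subseteq> sets M"
    using assms by (auto intro: measurable_sets)
  then show ?thesis
    unfolding subalgebra_def gen_algebra_def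
    by (simp add: space_measure_of_conv sets.sigma_sets_subset order_trans[OF _ sets.space_closed])
qed

lemma borel_measurable_gen_algebra:
  fixes h :: "'i \<Rightarrow> 'w \<Rightarrow> 'b::topological_space"
  assumes "i \<in> I"
  shows "h i \<in> borel_measurable (gen_algebra M h I)"
proof (rule measurableI)
  fix B :: "'b set" assume "B \<in> sets borel"
  with assms have "h i -` B \<inter> space M \<in> (\<Union>i\<in>I. {h i -` B \<inter> space M | B. B \<in> sets borel})"
    by blast
  moreover have "(\<Union>i\<in>I. {h i -` B \<inter> space M | B. B \<in> sets borel}) \<subseteq> Pow (space M)"
    by auto
  ultimately show "h i -` B \<inter> space (gen_algebra M h I) \<in> sets (gen_algebra M h I)"
    by (simp add: gen_algebra_def space_measure_of_conv sigma_sets.Basic)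
qed simp

text \<open>
  Since \<open>Z\<close> is measurable with respect to \<open>F\<close>, the deviation equals that of \<open>X - Z\<close>, so it is at most
  \<open>2 c T\<close> with \<open>T = (D + E(D | F)) / 2\<close>. From \<open>0 \<le> T \<le> 1\<close> follows \<open>T\<^sup>p \<le> T\<close>, and \<open>T\<close> has the
  same mean as \<open>D\<close>.
\<close>

lemma (in prob_space) cond_exp_deviation_moment:
  fixes X Z D :: "'a \<Rightarrow> real"
  assumes F: "subalgebra M F"
    and X: "X \<in> borel_measurable M" "AE \<omega> in M. \<bar>X \<omega>\<bar> \<le> K"
    and Z: "Z \<in> borel_measurable F"
    and D [measurable]: "D \<in> borel_measurable M" and D01: "\<And>\<omega>. 0 \<le> D \<omega>" "\<And>\<omega>. D \<omega> \<le> 1"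
    and close: "AE \<omega> in M. \<bar>X \<omega> - Z \<omega>\<bar> \<le> c * D \<omega>" and c: "0 \<le> c" and p: "1 \<le> p"
  shows "(\<integral>\<^sup>+\<omega>. ennreal (\<bar>X \<omega> - real_cond_exp M F X \<omega>\<bar> powr p) \<partial>M)
    \<le> ennreal ((2 * c) powr p * expectation D)"
proof -
  interpret finite_measure_subalgebra M F
    using F by unfold_locales
  have ZM: "Z \<in> borel_measurable M"
    by (rule measurable_from_subalg[OF F Z])
  have intX: "integrable M X"
    using X by (intro integrable_const_bound[where B = K]) auto
  have intD: "integrable M D"
    using D01 by (intro integrable_const_bound[where B = 1]) auto
  have "AE \<omega> in M. \<bar>X \<omega> - Z \<omega>\<bar> \<le> c"
    using close
  proof eventually_elim
    case (elim \<omega>)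
    then show ?case using mult_left_le[OF D01(2) c, of \<omega>] by simp
  qed
  then have intXZ: "integrable M (\<lambda>\<omega>. X \<omega> - Z \<omega>)"
    using X(1) ZM by (intro integrable_const_bound[where B = c]) auto
  have intZ: "integrable M Z"
    using Bochner_Integration.integrable_diff[OF intX intXZ] by simp
  let ?E = "real_cond_exp M F"
  have up: "AE \<omega> in M. ?E (\<lambda>\<omega>. X \<omega> - Z \<omega>) \<omega> \<le> ?E (\<lambda>\<omega>. c * D \<omega>) \<omega>"
    using close by (intro real_cond_exp_mono intXZ) (auto intro: intD)
  have lo: "AE \<omega> in M. ?E (\<lambda>\<omega>. (- c) * D \<omega>) \<omega> \<le> ?E (\<lambda>\<omega>. X \<omega> - Z \<omega>) \<omega>"
    using close by (intro real_cond_exp_mono intXZ) (auto intro: intD)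
  have D_ge: "AE \<omega> in M. 0 \<le> ?E D \<omega>" and D_le: "AE \<omega> in M. ?E D \<omega> \<le> 1"
    using D01 by (auto intro!: real_cond_exp_ge_c real_cond_exp_le_c intD)
  let ?T = "\<lambda>\<omega>. (D \<omega> + ?E D \<omega>) / 2"
  have "AE \<omega> in M. \<bar>X \<omega> - ?E X \<omega>\<bar> powr p \<le> (2 * c) powr p * ?T \<omega>"
    using close up lo D_ge D_le real_cond_exp_diff[OF intX intZ] real_cond_exp_F_meas[OF intZ Z]
      real_cond_exp_cmult[OF intD, of c] real_cond_exp_cmult[OF intD, of "- c"]
  proof eventually_elim
    case (elim \<omega>)
    have T: "0 \<le> ?T \<omega>" "?T \<omega> \<le> 1"
      using elim D01[of \<omega>] by auto
    have "\<bar>X \<omega> - ?E X \<omega>\<bar> \<le> c * D \<omega> + c * ?E D \<omega>"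
      using elim by (auto simp: abs_le_iff)
    also have "\<dots> = (2 * c) * ?T \<omega>"
      by (simp add: algebra_simps)
    finally have "\<bar>X \<omega> - ?E X \<omega>\<bar> powr p \<le> ((2 * c) * ?T \<omega>) powr p"
      using p by (intro powr_mono2) auto
    also have "\<dots> = (2 * c) powr p * ?T \<omega> powr p"
      by (rule powr_mult)
    also have "?T \<omega> powr p \<le> ?T \<omega>"
      using powr_mono'[OF p T] T by simp
    finally show ?case
      by (simp add: mult_left_mono)
  qed
  then have "(\<integral>\<^sup>+\<omega>. ennreal (\<bar>X \<omega> - ?E X \<omega>\<bar> powr p) \<partial>M) \<le> (\<integral>\<^sup>+\<omega>. ennreal ((2 * c) powr p * ?T \<omega>) \<partial>M)"
    by (intro nn_integral_mono_AE, eventually_elim) (rule ennreal_leI)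
  also have "\<dots> = ennreal (\<integral>\<omega>. (2 * c) powr p * ?T \<omega> \<partial>M)"
  proof (rule nn_integral_eq_integral)
    show "AE \<omega> in M. 0 \<le> (2 * c) powr p * ?T \<omega>"
      using D_ge by eventually_elim (simp add: D01)
  qed (use intD real_cond_exp_int(1)[OF intD] in auto)
  also have "(\<integral>\<omega>. (2 * c) powr p * ?T \<omega> \<partial>M) = (2 * c) powr p * expectation D"
    using intD real_cond_exp_int[OF intD] by simp
  finally show ?thesis .
qed

lemma Lp_norm_le:
  assumes "(\<integral>\<^sup>+\<omega>. ennreal (\<bar>f \<omega>\<bar> powr p) \<partial>M) \<le> ennreal (b powr p * a)" "0 \<le> a" "0 \<le> b" "0 < p"
  shows "Lp_norm M p f \<le> ennreal (b * a powr (1 / p))"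
proof -
  define I where "I = (\<integral>\<^sup>+\<omega>. ennreal (\<bar>f \<omega>\<bar> powr p) \<partial>M)"
  have I: "I \<le> ennreal (b powr p * a)"
    using assms(1) by (simp add: I_def)
  then have "I \<noteq> \<infinity>"
    by (auto simp: top_unique)
  have "enn2real I \<le> b powr p * a"
    using I assms by (intro enn2real_leI) auto
  then have "enn2real I powr (1 / p) \<le> (b powr p * a) powr (1 / p)"
    using assms by (intro powr_mono2) auto
  also have "\<dots> = b * a powr (1 / p)"
    using assms by (simp add: powr_mult powr_powr)
  finally show ?thesis
    using \<open>I \<noteq> \<infinity>\<close> by (simp add: Lp_norm_def I_def[symmetric] ennreal_leI)
qed

text \<open>
  The loss from rounding \<open>r / n\<close> down to \<open>r div n\<close> is less than one factor \<open>1 / c \<le> 2\<close>, uniformly in \<open>p\<close>.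
\<close>

lemma powr_rate_le:
  fixes c p :: real
  assumes c: "1 / 2 \<le> c" "c < 1" and "1 \<le> n" "1 \<le> p"
  shows "(c powr (1 / real n)) powr (- real r / p) * (c ^ (r div n)) powr (1 / p) \<le> 2"
proof -
  define e where "e = (real r / real n - real (r div n)) / p"
  have "real r = real n * real (r div n) + real (r mod n)"
    by (metis div_mult_mod_eq mult.commute of_nat_add of_nat_mult)
  then have "real r / real n - real (r div n) = real (r mod n) / real n"
    using \<open>1 \<le> n\<close> by (simp add: field_simps)
  moreover have "real (r mod n) / real n \<le> 1" "0 \<le> real (r mod n) / real n"
    using \<open>1 \<le> n\<close> by (auto simp: divide_le_eq_1)
  ultimately have e: "e \<le> 1"
    using \<open>1 \<le> p\<close> unfolding e_def by (subst pos_divide_le_eq) linarith+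
  have "(c powr (1 / real n)) powr (- real r / p) * (c ^ (r div n)) powr (1 / p)
      = c powr (- (real r / real n) / p) * c powr (real (r div n) / p)"
    using c by (simp add: powr_powr flip: powr_realpow)
  also have "\<dots> = c powr (- e)"
    by (simp add: e_def diff_divide_distrib flip: powr_add)
  also have "\<dots> \<le> c powr (- 1)"
    using c e by (intro powr_mono') auto
  also have "\<dots> \<le> 2"
    using c by (simp add: powr_minus field_simps)
  finally show ?thesis .
qed

section \<open>The hypotheses in terms of vectors\<close>

lemma proj_act_span: "proj_act g (span {x}) = span {g *v x}"
  unfolding proj_act_def using linear_span_image[OF matrix_vector_mul_linear, of g "{x}"] by simp

lemma AE_mat_N_bounded:
  fixes g :: "nat \<Rightarrow> 'w \<Rightarrow> real^'n^'n"
  assumes "(SUP j\<in>{1..}. Linf_norm M (\<lambda>\<omega>. mat_N (g j \<omega>))) < \<infinity>"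
  obtains B where "1 \<le> B" "AE \<omega> in M. \<forall>j\<ge>1. mat_N (g j \<omega>) \<le> B"
proof -
  obtain b :: nat where b: "(SUP j\<in>{1..}. Linf_norm M (\<lambda>\<omega>. mat_N (g j \<omega>))) < ereal (real b)"
    using assms less_PInf_Ex_of_nat by auto
  have "AE \<omega> in M. mat_N (g j \<omega>) \<le> max 1 (real b)" if "1 \<le> j" for j
  proof -
    have "Linf_norm M (\<lambda>\<omega>. mat_N (g j \<omega>)) \<le> (SUP j\<in>{1..}. Linf_norm M (\<lambda>\<omega>. mat_N (g j \<omega>)))"
      using that by (intro SUP_upper) auto
    with b have le: "Linf_norm M (\<lambda>\<omega>. mat_N (g j \<omega>)) \<le> ereal (real b)"
      by (meson le_less_trans less_imp_le)
    show ?thesis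
      using esssup_AE[of "\<lambda>\<omega>. ereal \<bar>mat_N (g j \<omega>)\<bar>" M]
    proof eventually_elim
      case (elim \<omega>)
      then have "ereal \<bar>mat_N (g j \<omega>)\<bar> \<le> ereal (real b)"
        using le unfolding Linf_norm_def by (rule order_trans)
      then show ?case by simp
    qed
  qed
  then have "AE \<omega> in M. \<forall>j. 1 \<le> j \<longrightarrow> mat_N (g j \<omega>) \<le> max 1 (real b)"
    by (subst AE_all_countable) (auto intro: AE_I2)
  then show thesis
    by (intro that[of "max 1 (real b)"]) auto
qed

lemma mean_ln_sin_angle_le:
  fixes g :: "nat \<Rightarrow> 'w \<Rightarrow> real^'n^'n"
  assumes inv: "\<And>j \<omega>. j \<ge> 1 \<Longrightarrow> \<omega> \<in> space M \<Longrightarrow> invertible (g j \<omega>)"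
    and sup: "(SUP j\<in>{1..}. SUP (x, y)\<in>{(x, y). x \<in> proj_space \<and> y \<in> proj_space \<and> x \<noteq> y}.
              ereal (\<integral>\<omega>. ln (proj_dist (proj_act (mat_prod (\<lambda>i. g i \<omega>) j n) x)
                                     (proj_act (mat_prod (\<lambda>i. g i \<omega>) j n) y)
                            / proj_dist x y) \<partial>M)) \<le> ereal (- \<delta>)"
    and "1 \<le> j" "x \<noteq> 0" "y \<noteq> 0" "sin_angle x y \<noteq> 0"
  shows "(\<integral>\<omega>. ln (sin_angle (mat_prod (\<lambda>i. g i \<omega>) j n *v x) (mat_prod (\<lambda>i. g i \<omega>) j n *v y)
            / sin_angle x y) \<partial>M) \<le> - \<delta>"
proof -
  have pd: "proj_dist (span {u}) (span {v}) = sin_angle u v" if "u \<noteq> 0" "v \<noteq> 0" for u v :: "real^'n"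
    using proj_dist_span[OF that] by (simp add: sin_angle_def)
  have neq: "span {x} \<noteq> span {y}"
    using pd[of x y] pd[of x x] assms(4-) by (auto simp: sin_angle_self)
  define f where "f j = (\<lambda>(L, L'). ereal (\<integral>\<omega>. ln (proj_dist (proj_act (mat_prod (\<lambda>i. g i \<omega>) j n) L)
      (proj_act (mat_prod (\<lambda>i. g i \<omega>) j n) L') / proj_dist L L') \<partial>M))" for j
  let ?S = "{(x, y). x \<in> proj_space \<and> y \<in> proj_space \<and> x \<noteq> y}"
  have "f j (span {x}, span {y}) \<le> (SUP z\<in>?S. f j z)"
    using neq \<open>x \<noteq> 0\<close> \<open>y \<noteq> 0\<close> by (intro SUP_upper) (auto simp: proj_space_def)
  also have "\<dots> \<le> (SUP j\<in>{1..}. SUP z\<in>?S. f j z)"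
    using \<open>1 \<le> j\<close> by (intro SUP_upper) auto
  also have "\<dots> \<le> ereal (- \<delta>)"
    using sup unfolding f_def .
  finally have "(\<integral>\<omega>. ln (proj_dist (proj_act (mat_prod (\<lambda>i. g i \<omega>) j n) (span {x}))
      (proj_act (mat_prod (\<lambda>i. g i \<omega>) j n) (span {y})) / proj_dist (span {x}) (span {y})) \<partial>M) \<le> - \<delta>"
    by (simp add: f_def)
  also have "(\<integral>\<omega>. ln (proj_dist (proj_act (mat_prod (\<lambda>i. g i \<omega>) j n) (span {x}))
      (proj_act (mat_prod (\<lambda>i. g i \<omega>) j n) (span {y})) / proj_dist (span {x}) (span {y})) \<partial>M)
    = (\<integral>\<omega>. ln (sin_angle (mat_prod (\<lambda>i. g i \<omega>) j n *v x) (mat_prod (\<lambda>i. g i \<omega>) j n *v y)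
            / sin_angle x y) \<partial>M)"
  proof (rule Bochner_Integration.integral_cong[OF refl])
    fix \<omega> assume "\<omega> \<in> space M"
    then have "invertible (mat_prod (\<lambda>i. g i \<omega>) j n)"
      using inv \<open>1 \<le> j\<close> by (intro invertible_mat_prod) auto
    then have "mat_prod (\<lambda>i. g i \<omega>) j n *v u \<noteq> 0" if "u \<noteq> 0" for u
      using inj_matrix_vector_mult[of "mat_prod (\<lambda>i. g i \<omega>) j n"] that
      by (metis inj_eq matrix_vector_mult_0_right)
    then show "ln (proj_dist (proj_act (mat_prod (\<lambda>i. g i \<omega>) j n) (span {x}))
      (proj_act (mat_prod (\<lambda>i. g i \<omega>) j n) (span {y})) / proj_dist (span {x}) (span {y}))
      = ln (sin_angle (mat_prod (\<lambda>i. g i \<omega>) j n *v x) (mat_prod (\<lambda>i. g i \<omega>) j n *v y) / sin_angle x y)"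
      using \<open>x \<noteq> 0\<close> \<open>y \<noteq> 0\<close> by (simp add: proj_act_span pd)
  qed
  finally show ?thesis .
qed

section \<open>Exponential approximation of the steps\<close>

text \<open>
  The proof takes \<open>\<rho> = c powr (1 / n)\<close>, where \<open>c = 1 - s \<delta> / 2\<close> is the factor gained per block, and
  \<open>C = 8 B\<^sup>2\<close>, which serves all \<open>p\<close>, \<open>k\<close> and \<open>r\<close> at once.
\<close>

lemma (in prob_space) step_var_Lp_approximation:
  fixes g :: "nat \<Rightarrow> 'a \<Rightarrow> real^'n^'n" and x0 :: "real^'n" and A :: "real^'n^'n"
  assumes ind: "indep_vars (\<lambda>_. borel) g {1..}"
    and dist: "AE \<omega> in M. \<forall>j\<ge>1. distortion_le B (g j \<omega>)" and B: "1 \<le> B"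
    and x0: "x0 \<noteq> 0"
    and n: "1 \<le> n" and \<delta>: "0 < \<delta>"
    and mean: "\<And>j x y. 1 \<le> j \<Longrightarrow> x \<noteq> 0 \<Longrightarrow> y \<noteq> 0 \<Longrightarrow> sin_angle x y \<noteq> 0 \<Longrightarrow>
      expectation (\<lambda>\<omega>. ln (sin_angle (mat_prod (\<lambda>i. g i \<omega>) j n *v x)
        (mat_prod (\<lambda>i. g i \<omega>) j n *v y) / sin_angle x y)) \<le> - \<delta>"
  obtains \<rho> C where "0 < \<rho>" "\<rho> < 1"
    "\<And>p k r. 1 \<le> p \<Longrightarrow> 1 \<le> k \<Longrightarrow> ennreal (\<rho> powr (- real r / p)) * Lp_norm M p
      (\<lambda>\<omega>. step_var g x0 k \<omega> - real_cond_exp M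
        (gen_algebra M (two_sided A g) {int k - int r..int k}) (step_var g x0 k) \<omega>) \<le> ennreal C"
proof -
  define L where "L = ln ((B ^ n) ^ 4)"
  have "0 \<le> L"
    using B by (simp add: L_def)
  \<comment> \<open>The last two entries make \<open>s * L \<le> 1\<close> and \<open>s * L\<^sup>2 \<le> \<delta> / 2\<close>, as the moment contraction requires,
    where \<open>L + 1\<close> avoids division by zero; \<open>1 / \<delta>\<close> gives \<open>c \<ge> 1 / 2\<close>; \<open>s \<le> 1\<close> serves to bound \<open>D\<close> by \<open>D powr s\<close>.\<close>
  define s where "s = Min {1, 1 / \<delta>, 1 / (L + 1), \<delta> / (2 * (L + 1)\<^sup>2)}"
  have s: "0 < s" "s \<le> 1" "s \<le> 1 / \<delta>" "s \<le> 1 / (L + 1)" "s \<le> \<delta> / (2 * (L + 1)\<^sup>2)"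
    using \<delta> \<open>0 \<le> L\<close> by (simp_all add: s_def)
  have sL: "s * L \<le> 1"
  proof -
    have "s * L \<le> s * (L + 1)" using s by simp
    also have "\<dots> \<le> 1" using s(4) \<open>0 \<le> L\<close> by (simp add: pos_le_divide_eq)
    finally show ?thesis .
  qed
  have sL2: "s * L\<^sup>2 \<le> \<delta> / 2"
  proof -
    have "s * L\<^sup>2 \<le> s * (L + 1)\<^sup>2" using s \<open>0 \<le> L\<close> by (simp add: power_mono)
    also have "\<dots> \<le> \<delta> / 2" using s(5) \<open>0 \<le> L\<close> by (simp add: pos_le_divide_eq mult_ac)
    finally show ?thesis .
  qed
  define c where "c = 1 - s * \<delta> / 2"
  have c: "1 / 2 \<le> c" "c < 1"
    using s \<delta> by (auto simp: c_def pos_le_divide_eq)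
  have g_meas: "g i \<in> borel_measurable M" if "1 \<le> i" for i
    using ind that by (auto simp: indep_vars_def)
  have prod_meas: "(\<lambda>\<omega>. mat_prod (\<lambda>i. g i \<omega>) j m) \<in> borel_measurable M" if "1 \<le> j" for j m
    using that by (intro borel_measurable_mat_prod g_meas) auto
  have contr: "(\<integral>\<^sup>+\<omega>. ennreal (sin_angle (mat_prod (\<lambda>i. g i \<omega>) j n *v x)
        (mat_prod (\<lambda>i. g i \<omega>) j n *v y) powr s) \<partial>M) \<le> ennreal c * ennreal (sin_angle x y powr s)"
    if "1 \<le> j" "x \<noteq> 0" "y \<noteq> 0" for j x y
    unfolding c_def
  proof (rule sin_angle_moment_contraction)
    show "AE \<omega> in M. distortion_le (B ^ n) (mat_prod (\<lambda>i. g i \<omega>) j n)"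
      using dist by eventually_elim (use that B in \<open>auto intro!: distortion_le_mat_prod\<close>)
    show "1 \<le> B ^ n"
      using B by simp
    show "s * (ln ((B ^ n) ^ 4))\<^sup>2 \<le> \<delta> / 2" "s * ln ((B ^ n) ^ 4) \<le> 1"
      using sL sL2 by (simp_all only: L_def)
  qed (use that s in \<open>simp_all add: prod_meas mean\<close>)

  have main: "ennreal ((c powr (1 / real n)) powr (- real r / p)) * Lp_norm M p
      (\<lambda>\<omega>. step_var g x0 k \<omega> - real_cond_exp M
        (gen_algebra M (two_sided A g) {int k - int r..int k}) (step_var g x0 k) \<omega>) \<le> ennreal (8 * B\<^sup>2)"
    if p: "1 \<le> p" and k: "1 \<le> k" for p :: real and k r :: nat
  proof -
    \<comment> \<open>The first index of the window that carries a random matrix; if the window reaches back to time \<open>1\<close>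
      or beyond, then \<open>j = 1\<close>, the vectors \<open>u\<close> and \<open>v\<close> below agree and \<open>D\<close> vanishes.\<close>
    define j where "j = max 1 (k - r)"
    define m where "m = k - j"
    have j: "1 \<le> j" "j + m = k" "k - 1 = (j - 1) + m"
      using k by (auto simp: j_def m_def)
    define F where "F = gen_algebra M (two_sided A g) {int k - int r..int k}"
    have F: "subalgebra M F"
      unfolding F_def by (rule subalgebra_gen_algebra) (simp add: two_sided_def g_meas)
    have g_F: "g i \<in> borel_measurable F" if "j \<le> i" "i \<le> k" for i
    proof -
      have "two_sided A g (int i) \<in> borel_measurable F"
        unfolding F_def using that by (intro borel_measurable_gen_algebra) (auto simp: j_def)
      moreover have "two_sided A g (int i) = g i"
        using that j by (simp add: two_sided_def)
      ultimately show ?thesis by simp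
    qed
    define u where "u \<omega> = mat_prod (\<lambda>i. g i \<omega>) 1 (k - 1) *v x0" for \<omega>
    define v where "v \<omega> = mat_prod (\<lambda>i. g i \<omega>) j m *v x0" for \<omega>
    define Z where "Z \<omega> = cocycle (g k \<omega>) (v \<omega>)" for \<omega>
    define D where "D \<omega> = sin_angle (u \<omega>) (v \<omega>)" for \<omega>
    have Z: "Z \<in> borel_measurable F"
      unfolding Z_def v_def using j
      by (intro borel_measurable_cocycle borel_measurable_matrix_vector_mult borel_measurable_mat_prod g_F)
        auto
    have D_meas: "D \<in> borel_measurable M"
      unfolding D_def u_def v_def using j
      by (intro borel_measurable_sin_angle borel_measurable_matrix_vector_mult prod_meas) auto
    have D01: "0 \<le> D \<omega>" "D \<omega> \<le> 1" for \<omega>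
      by (simp_all add: D_def sin_angle_nonneg sin_angle_le_1)
    have X: "step_var g x0 k \<omega> = cocycle (g k \<omega>) (u \<omega>)" for \<omega>
      by (simp add: step_var_def u_def)
    have X_meas: "step_var g x0 k \<in> borel_measurable M"
      unfolding X[abs_def] u_def using k
      by (intro borel_measurable_cocycle borel_measurable_matrix_vector_mult prod_meas g_meas) auto
    have *: "AE \<omega> in M. \<bar>step_var g x0 k \<omega>\<bar> \<le> ln B \<and> \<bar>step_var g x0 k \<omega> - Z \<omega>\<bar> \<le> (2 * B\<^sup>2) * D \<omega>"
      using dist
    proof eventually_elim
      case (elim \<omega>)
      have nz: "mat_prod (\<lambda>i. g i \<omega>) i l *v x0 \<noteq> 0" if "1 \<le> i" for i l
        using elim that B
        by (intro distortion_le_nonzero[OF _ x0, of "B ^ l"] distortion_le_mat_prod) auto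
      have "u \<omega> \<noteq> 0" "v \<omega> \<noteq> 0"
        unfolding u_def v_def using j by (auto intro!: nz)
      moreover have "distortion_le B (g k \<omega>)"
        using elim k by simp
      ultimately show ?case
        using cocycle_bounded[of B "g k \<omega>" "u \<omega>"] cocycle_lipschitz[of B "g k \<omega>" "u \<omega>" "v \<omega>"] B
        by (simp add: X Z_def D_def)
    qed
    have ED: "expectation D \<le> c ^ (r div n)"
    proof (cases "r < k")
      case True
      then have "m = r"
        by (auto simp: m_def j_def)
      have "ennreal (expectation D) = (\<integral>\<^sup>+\<omega>. ennreal (D \<omega>) \<partial>M)"
        using D_meas D01
        by (intro nn_integral_eq_integral[symmetric] integrable_const_bound[where B = 1]) auto
      also have "\<dots> \<le> (\<integral>\<^sup>+\<omega>. ennreal (D \<omega> powr s) \<partial>M)"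
        using powr_mono'[of s 1] s D01 by (intro nn_integral_mono ennreal_leI) (metis powr_one)
      also have "\<dots> \<le> ennreal c ^ (r div n)"
        using sin_angle_moment_decay[OF ind dist B contr x0 x0 n s(1) j(1), of m]
        unfolding D_def u_def v_def j(3) \<open>m = r\<close> by simp
      also have "\<dots> = ennreal (c ^ (r div n))"
        using c by (simp add: ennreal_power)
      finally show ?thesis
        using c by (subst (asm) ennreal_le_iff) auto
    next
      case False
      then have "j = 1" "m = k - 1"
        using k by (auto simp: m_def j_def)
      then have "D = (\<lambda>_. 0)"
        by (simp add: fun_eq_iff D_def u_def v_def sin_angle_self)
      then show ?thesis
        using c by simp
    qed
    have "0 \<le> expectation D"
      using D01 by simp
    have "(\<integral>\<^sup>+\<omega>. ennreal (\<bar>step_var g x0 k \<omega> - real_cond_exp M F (step_var g x0 k) \<omega>\<bar> powr p) \<partial>M)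
        \<le> ennreal ((2 * (2 * B\<^sup>2)) powr p * expectation D)"
      by (rule cond_exp_deviation_moment[where K = "ln B", OF F X_meas _ Z D_meas D01]) (use * p in auto)
    then have "Lp_norm M p (\<lambda>\<omega>. step_var g x0 k \<omega> - real_cond_exp M F (step_var g x0 k) \<omega>)
        \<le> ennreal (2 * (2 * B\<^sup>2) * expectation D powr (1 / p))"
      using \<open>0 \<le> expectation D\<close> p by (intro Lp_norm_le) auto
    also have "\<dots> \<le> ennreal (2 * (2 * B\<^sup>2) * (c ^ (r div n)) powr (1 / p))"
      using ED \<open>0 \<le> expectation D\<close> p by (intro ennreal_leI mult_left_mono powr_mono2) auto
    finally have "ennreal ((c powr (1 / real n)) powr (- real r / p)) *
          Lp_norm M p (\<lambda>\<omega>. step_var g x0 k \<omega> - real_cond_exp M F (step_var g x0 k) \<omega>)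
        \<le> ennreal ((c powr (1 / real n)) powr (- real r / p))
          * ennreal (2 * (2 * B\<^sup>2) * (c ^ (r div n)) powr (1 / p))"
      by (rule mult_left_mono) simp
    also have "\<dots> = ennreal ((4 * B\<^sup>2) * ((c powr (1 / real n)) powr (- real r / p) * (c ^ (r div n)) powr (1 / p)))"
      by (simp add: mult_ac flip: ennreal_mult)
    also have "\<dots> \<le> ennreal ((4 * B\<^sup>2) * 2)"
      using powr_rate_le[OF c n p] by (intro ennreal_leI mult_left_mono) auto
    finally show ?thesis
      by (simp add: F_def)
  qed
  show thesis
  proof (rule that[OF _ _ main])
    show "0 < c powr (1 / real n)"
      using c by simp
    have "c powr (1 / real n) < 1 powr (1 / real n)"
      using c n by (intro powr_less_mono2) auto
    then show "c powr (1 / real n) < 1"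
      by simp
  qed auto
qed

theorem proposition2p3:
  fixes M :: "'w measure"
    and g :: "nat \<Rightarrow> 'w \<Rightarrow> real^'n^'n"
    and x0 :: "real^'n"
    and A :: "real^'n^'n"
  assumes "prob_space M"
    and "CARD('n) \<ge> 2"
    and "\<And>j \<omega>. j \<ge> 1 \<Longrightarrow> \<omega> \<in> space M \<Longrightarrow> invertible (g j \<omega>)"
    and "prob_space.indep_vars M (\<lambda>_. borel) g {1..}"
    and "norm x0 = 1"
    and "(SUP j\<in>{1..}. Linf_norm M (\<lambda>\<omega>. mat_N (g j \<omega>))) < \<infinity>"
    and "\<exists>n0::nat. \<exists>\<delta>::real. n0 \<ge> 1 \<and> \<delta> > 0 \<and>
           (SUP j\<in>{1..}. SUP (x, y)\<in>{(x, y). x \<in> proj_space \<and> y \<in> proj_space \<and> x \<noteq> y}.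
              ereal (\<integral>\<omega>. ln (proj_dist (proj_act (mat_prod (\<lambda>i. g i \<omega>) j n0) x)
                                     (proj_act (mat_prod (\<lambda>i. g i \<omega>) j n0) y)
                            / proj_dist x y) \<partial>M)) \<le> ereal (- \<delta>)"
    and "invertible A"
  shows "\<exists>\<rho>::real. 0 < \<rho> \<and> \<rho> < 1 \<and>
           (\<forall>p::real. p \<ge> 1 \<longrightarrow>
              (SUP k\<in>{1::nat..}. SUP r\<in>(UNIV::nat set).
                 ennreal (\<rho> powr (- real r / p)) *
                 Lp_norm M p
                   (\<lambda>\<omega>. step_var g x0 k \<omega>
                        - real_cond_exp M
                            (gen_algebra M (two_sided A g) {int k - int r..int k})
                            (step_var g x0 k) \<omega>)) < \<infinity>)"
proof -
  interpret prob_space M by (rule assms(1))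
  obtain n \<delta> where n: "1 \<le> n" and \<delta>: "0 < \<delta>"
    and sup: "(SUP j\<in>{1..}. SUP (x, y)\<in>{(x, y). x \<in> proj_space \<and> y \<in> proj_space \<and> x \<noteq> y}.
              ereal (\<integral>\<omega>. ln (proj_dist (proj_act (mat_prod (\<lambda>i. g i \<omega>) j n) x)
                                     (proj_act (mat_prod (\<lambda>i. g i \<omega>) j n) y)
                            / proj_dist x y) \<partial>M)) \<le> ereal (- \<delta>)"
    using assms(7) by blast
  obtain B where B: "1 \<le> B" and N: "AE \<omega> in M. \<forall>j\<ge>1. mat_N (g j \<omega>) \<le> B"
    using AE_mat_N_bounded[OF assms(6)] .
  have dist: "AE \<omega> in M. \<forall>j\<ge>1. distortion_le B (g j \<omega>)"
    using N AE_space by eventually_elim (simp add: distortion_le_mat_N assms(3))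
  have "x0 \<noteq> 0"
    using assms(5) by auto
  have mean: "expectation (\<lambda>\<omega>. ln (sin_angle (mat_prod (\<lambda>i. g i \<omega>) j n *v x)
      (mat_prod (\<lambda>i. g i \<omega>) j n *v y) / sin_angle x y)) \<le> - \<delta>"
    if "1 \<le> j" "x \<noteq> 0" "y \<noteq> 0" "sin_angle x y \<noteq> 0" for j and x y :: "real^'n"
    using assms(3) sup that by (rule mean_ln_sin_angle_le)
  show ?thesis
  proof (rule step_var_Lp_approximation[where A = A, OF assms(4) dist B \<open>x0 \<noteq> 0\<close> n \<delta> mean])
    fix \<rho> C :: real
    assume \<rho>: "0 < \<rho>" "\<rho> < 1"
    assume le: "\<And>p k r. 1 \<le> p \<Longrightarrow> 1 \<le> k \<Longrightarrow> ennreal (\<rho> powr (- real r / p)) * Lp_norm M p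
      (\<lambda>\<omega>. step_var g x0 k \<omega> - real_cond_exp M
        (gen_algebra M (two_sided A g) {int k - int r..int k}) (step_var g x0 k) \<omega>) \<le> ennreal C"
    have "(SUP k\<in>{1::nat..}. SUP r\<in>(UNIV::nat set). ennreal (\<rho> powr (- real r / p)) * Lp_norm M p
        (\<lambda>\<omega>. step_var g x0 k \<omega> - real_cond_exp M
          (gen_algebra M (two_sided A g) {int k - int r..int k}) (step_var g x0 k) \<omega>)) < \<infinity>"
      if "1 \<le> p" for p :: real
    proof (rule le_less_trans)
      show "(SUP k\<in>{1::nat..}. SUP r\<in>(UNIV::nat set). ennreal (\<rho> powr (- real r / p)) * Lp_norm M p
          (\<lambda>\<omega>. step_var g x0 k \<omega> - real_cond_exp M
            (gen_algebra M (two_sided A g) {int k - int r..int k}) (step_var g x0 k) \<omega>)) \<le> ennreal C"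
        by (intro SUP_least le that) simp
    qed simp
    with \<rho> show ?thesis
      by (intro exI[of _ \<rho>] conjI allI impI)
  qed
qed

end
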